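(* Let the isosceles triangle $ABC$ with base angles $\alpha$ be $N$-tiled by a tile with angles $(\alpha,\beta,2\pi/3)$ and sides $(a,b,c)$, which are integers with no common factor. Suppose $\alpha$ is not a rational multiple of $\pi$. Then (i) $2b+a$ divides $N$, and $Nb/(2b+a)$ is a square, say $m^2$ with $m$ a positive integer; (ii) the length $X$ of the two equal sides $AB$ and $BC$ and the length $Y$ of the base $AC$ are given by $X=mc$ and $Y=m(2b+a)$.
   Context: An $N$-tiling of a triangle $ABC$ by a triangle $T$ (the tile) is a set of $N$ triangles congruent to $T$ (reflections allowed) whose interiors are pairwise disjoint and whose union is $ABC$ (tiles need not meet edge to edge). The sides $a,b,c$ of the tile are opposite its angles $\alpha,\beta,2\pi/3$ respectively. "Isosceles" means exactly two sides are equal. *)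

theory Defs
  imports "HOL-Analysis.Analysis"
begin

text \<open>The (unsigned) angle at the vertex \<open>Q\<close>, in \<open>[0, \<pi>]\<close>; meaningful for \<open>P \<noteq> Q\<close> and \<open>R \<noteq> Q\<close>.\<close>

definition vertex_angle :: "real^2 \<Rightarrow> real^2 \<Rightarrow> real^2 \<Rightarrow> real" where
  "vertex_angle P Q R = arccos (((P - Q) \<bullet> (R - Q)) / (norm (P - Q) * norm (R - Q)))"

definition nondegenerate_triangle :: "real^2 \<Rightarrow> real^2 \<Rightarrow> real^2 \<Rightarrow> bool" where
  "nondegenerate_triangle A B C \<longleftrightarrow> \<not> collinear {A, B, C}"

abbreviation triangle_region :: "real^2 \<Rightarrow> real^2 \<Rightarrow> real^2 \<Rightarrow> (real^2) set" where
  "triangle_region A B C \<equiv> convex hull {A, B, C}"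

text \<open>Distance-preserving maps of the plane include the orientation-reversing ones, so
  reflected copies count as congruent.\<close>

definition congruent_regions :: "(real^2) set \<Rightarrow> (real^2) set \<Rightarrow> bool" where
  "congruent_regions S T \<longleftrightarrow> (\<exists>f. (\<forall>x y. dist (f x) (f y) = dist x y) \<and> f ` S = T)"

text \<open>Tiles need not meet edge to edge.\<close>

definition tiling :: "nat \<Rightarrow> (real^2) set \<Rightarrow> (real^2) set \<Rightarrow> (real^2) set set \<Rightarrow> bool" where
  "tiling N \<Delta> T \<T> \<longleftrightarrow>
     finite \<T> \<and> card \<T> = N \<and>
     (\<forall>S\<in>\<T>. congruent_regions T S) \<and>
     pairwise (\<lambda>S S'. interior S \<inter> interior S' = {}) \<T> \<and>
     \<Union>\<T> = \<Delta>"

definition tiled_by :: "nat \<Rightarrow> (real^2) set \<Rightarrow> (real^2) set \<Rightarrow> bool" where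
  "tiled_by N \<Delta> T \<longleftrightarrow> (\<exists>\<T>. tiling N \<Delta> T \<T>)"

text \<open>Isosceles with apex \<open>B\<close> and base \<open>AC\<close>; exactly two sides are equal, so equilateral
  triangles are excluded.\<close>

definition isosceles_with_apex :: "real^2 \<Rightarrow> real^2 \<Rightarrow> real^2 \<Rightarrow> bool" where
  "isosceles_with_apex A B C \<longleftrightarrow>
     nondegenerate_triangle A B C \<and> dist A B = dist B C \<and> dist A C \<noteq> dist A B"

text \<open>\<open>P\<close>, \<open>Q\<close>, \<open>R\<close> are the vertices at the angles \<open>\<alpha>\<close>, \<open>\<beta>\<close>, \<open>\<gamma>\<close>, opposite the sides
  \<open>a\<close>, \<open>b\<close>, \<open>c\<close>.\<close>

definition triangle_with_sides_angles ::
  "real^2 \<Rightarrow> real^2 \<Rightarrow> real^2 \<Rightarrow> real \<Rightarrow> real \<Rightarrow> real \<Rightarrow> real \<Rightarrow> real \<Rightarrow> real \<Rightarrow> bool" where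
  "triangle_with_sides_angles P Q R a b c \<alpha> \<beta> \<gamma> \<longleftrightarrow>
     nondegenerate_triangle P Q R \<and>
     dist Q R = a \<and> dist R P = b \<and> dist P Q = c \<and>
     vertex_angle R P Q = \<alpha> \<and> vertex_angle P Q R = \<beta> \<and> vertex_angle Q R P = \<gamma>"

end

theory Submission
  imports Defs
begin

text \<open>
  Write \<open>X = AB = BC\<close> and \<open>Y = AC\<close>. The cosine rule, in the tile and in the triangle, gives
  \<open>c\<^sup>2 = a\<^sup>2 + a b + b\<^sup>2\<close> and \<open>Y / X = 2 cos \<alpha> = (2 b + a) / c\<close>, and comparing areas turns this
  into \<open>X\<^sup>2 (2 b + a) = N b c\<^sup>2\<close>. So the shape and the area fix \<open>X\<close> up to the claim that \<open>X / c\<close>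
  is an integer, which follows from two facts.

  First, \<open>X\<close> is an integer, because the side \<open>AB\<close> is paved by edges of tiles
  (\<open>triangle_tiling_side_length\<close>). All tiles lie on one side of the line \<open>AB\<close>, so each of them
  meets this line in the empty set, a vertex or a complete edge
  (\<open>triangle_supporting_line_cases\<close>), and two tiles with disjoint interiors cannot share two
  points of the line (\<open>same_side_contact_unique\<close>). Comparing one-dimensional measures, \<open>X\<close> is a sum
  of numbers among \<open>0, a, b, c\<close>.

  Second, \<open>2 b + a\<close> is coprime to \<open>c\<close> (\<open>tile_sides_coprime\<close>). Hence \<open>X\<^sup>2 (2 b + a) = N b c\<^sup>2\<close>
  forces \<open>c\<close> to divide \<open>X\<close>. With \<open>X = m c\<close> the equation reads \<open>N b = m\<^sup>2 (2 b + a)\<close>, and since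
  \<open>2 b + a\<close> is also coprime to \<open>b\<close>, it divides \<open>N\<close>.
\<close>

section \<open>Congruent copies of a triangle and areas\<close>

text \<open>An isometry is a linear map followed by a translation, so it commutes with convex hulls.\<close>

lemma congruent_triangle_vertices:
  fixes P Q R :: "real^2"
  assumes "congruent_regions (triangle_region P Q R) S"
  obtains P' Q' R' where "S = triangle_region P' Q' R'"
    "dist P' Q' = dist P Q" "dist Q' R' = dist Q R" "dist R' P' = dist R P"
proof -
  obtain f where iso: "\<And>x y. dist (f x) (f y) = dist x y"
    and S: "f ` (triangle_region P Q R) = S"
    using assms unfolding congruent_regions_def by blast
  define g where "g x = f x - f 0" for x
  have "linear g"
    using iso by (intro isometry_linear) (simp_all add: g_def dist_norm)
  have f: "f = (\<lambda>x. f 0 + x) \<circ> g"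
    by (auto simp: g_def)
  have "f ` (convex hull {P, Q, R}) = (\<lambda>x. f 0 + x) ` (g ` (convex hull {P, Q, R}))"
    by (subst f) (simp only: image_comp)
  also have "\<dots> = convex hull ((\<lambda>x. f 0 + x) ` (g ` {P, Q, R}))"
    by (simp only: convex_hull_linear_image[OF \<open>linear g\<close>] convex_hull_translation)
  also have "(\<lambda>x. f 0 + x) ` (g ` {P, Q, R}) = {f P, f Q, f R}"
    by (simp add: g_def)
  finally show thesis
    using that[of "f P" "f Q" "f R"] S iso by simp
qed

text \<open>By Heron's formula the area depends on the side lengths only.\<close>

lemma measure_triangle_cong:
  fixes P Q R P' Q' R' :: "real^2"
  assumes "dist P' Q' = dist P Q" "dist Q' R' = dist Q R" "dist R' P' = dist R P"
  shows "measure lebesgue (triangle_region P' Q' R') = measure lebesgue (triangle_region P Q R)"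
  using assms
  by (simp add: heron dist_commute measure_completion borel_compact finite_imp_compact_convex_hull)

lemma interior_triangle_nonempty:
  fixes A B C :: "real^2"
  assumes "\<not> collinear {A, B, C}"
  shows "interior (triangle_region A B C) \<noteq> {}"
proof -
  let ?t = "1/3 :: real"
  have "?t *\<^sub>R A + ?t *\<^sub>R B + ?t *\<^sub>R C \<in> interior (triangle_region A B C)"
    unfolding interior_convex_hull_3_minimal[OF assms, simplified]
    by (intro CollectI exI[of _ ?t] conjI) auto
  then show ?thesis by blast
qed

text \<open>Together with \<open>measure_triangle_cong\<close> this shows that every congruent copy of the tile has interior points.\<close>

lemma measure_convex_pos_iff:
  fixes S :: "'a::euclidean_space set"
  assumes "convex S" "compact S"
  shows "interior S \<noteq> {} \<longleftrightarrow> measure lebesgue S > 0"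
  by (metis assms lmeasurable_compact negligible_convex_interior negligible_iff_measure0 measure_nonneg
      order_less_le order_less_irrefl)

text \<open>The intersection is itself convex, and a convex set with empty interior is negligible. Thus tiles
  with disjoint interiors overlap in a null set, which makes areas additive over a tiling.\<close>

lemma negligible_convex_Int:
  fixes S T :: "'a::euclidean_space set"
  assumes "convex S" "convex T" "interior S \<inter> interior T = {}"
  shows "negligible (S \<inter> T)"
proof -
  have "interior (S \<inter> T) = {}"
    using assms by simp
  then show ?thesis
    using assms by (simp add: negligible_convex_interior convex_Int)
qed

lemma triangle_tiling_area:
  assumes "tiling N (triangle_region A B C) (triangle_region P Q R) \<T>"
  shows "measure lebesgue (triangle_region A B C) = real N * measure lebesgue (triangle_region P Q R)"
proof -
  have tile: "\<exists>P' Q' R'. S = triangle_region P' Q' R' \<and>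
      measure lebesgue S = measure lebesgue (triangle_region P Q R)" if S: "S \<in> \<T>" for S
  proof -
    have "congruent_regions (triangle_region P Q R) S"
      using assms S by (simp add: tiling_def)
    then obtain P' Q' R' where "S = triangle_region P' Q' R'"
      "dist P' Q' = dist P Q" "dist Q' R' = dist Q R" "dist R' P' = dist R P"
      by (rule congruent_triangle_vertices)
    then show ?thesis
      using measure_triangle_cong by blast
  qed
  have *: "convex S" "S \<in> lmeasurable" if "S \<in> \<T>" for S
    using tile[OF that]
    by (auto intro!: lmeasurable_compact finite_imp_compact_convex_hull)
  have "measure lebesgue (\<Union>\<T>) = (\<Sum>S\<in>\<T>. measure lebesgue S)"
  proof (rule measure_negligible_finite_Union)
    show "pairwise (\<lambda>S T. negligible (S \<inter> T)) \<T>"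
      using assms * negligible_convex_Int unfolding tiling_def pairwise_def by metis
  qed (use assms * in \<open>auto simp: tiling_def\<close>)
  also have "\<dots> = (\<Sum>S\<in>\<T>. measure lebesgue (triangle_region P Q R))"
    by (rule sum.cong) (use tile in auto)
  finally show ?thesis
    using assms by (simp add: tiling_def)
qed

section \<open>How a tile meets a side\<close>

text \<open>This makes the line \<open>AB\<close> a supporting line of the triangle, with a normal pointing to the side of \<open>C\<close>.\<close>

lemma edge_normal_exists:
  fixes A B C :: "'a::real_inner"
  assumes "\<not> collinear {A, B, C}"
  obtains n where "n \<bullet> B = n \<bullet> A" "n \<bullet> C > n \<bullet> A"
proof -
  \<comment> \<open>The normal is the component of \<open>C - A\<close> orthogonal to \<open>B - A\<close>.\<close>
  define r where "r = ((C - A) \<bullet> (B - A)) / ((B - A) \<bullet> (B - A))"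
  define n where "n = (C - A) - r *\<^sub>R (B - A)"
  have AB: "A \<noteq> B"
    using assms by auto
  have orth: "n \<bullet> (B - A) = 0"
    using AB by (simp add: n_def inner_diff_left[of "C - A"] r_def)
  have "n \<noteq> 0"
  proof
    assume "n = 0"
    then have "C = r *\<^sub>R B + (1 - r) *\<^sub>R A"
      by (simp add: n_def algebra_simps)
    then have "collinear {B, C, A}"
      by (auto simp: collinear_3_expand)
    then show False
      using assms by (simp add: insert_commute)
  qed
  have "n \<bullet> (C - A) = n \<bullet> n + r * (n \<bullet> (B - A))"
    by (simp add: n_def inner_diff_right)
  then have "n \<bullet> (C - A) > 0"
    using orth \<open>n \<noteq> 0\<close> by simp
  with orth show thesis
    by (intro that[of n]) (simp_all add: inner_diff_right)
qed

text \<open>The left-hand side is a face of the hull, and a face of the hull of a compact set is the hull of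
  those points of the set that lie on it.\<close>

lemma convex_hull_Int_supporting_hyperplane:
  fixes V :: "'a::euclidean_space set"
  assumes "compact V" and "\<And>v. v \<in> V \<Longrightarrow> n \<bullet> v \<ge> k"
  shows "convex hull V \<inter> {x. n \<bullet> x = k} = convex hull (V \<inter> {x. n \<bullet> x = k})"
proof
  have "convex hull V \<subseteq> {x. n \<bullet> x \<ge> k}"
    using assms(2) by (intro hull_minimal) (auto simp: convex_halfspace_ge)
  then have "(convex hull V \<inter> {x. n \<bullet> x = k}) face_of (convex hull V)"
    by (intro face_of_Int_supporting_hyperplane_ge) auto
  then obtain F where F: "F \<subseteq> V" "convex hull V \<inter> {x. n \<bullet> x = k} = convex hull F"
    using face_of_convex_hull_subset[OF \<open>compact V\<close>] by metis
  then have "F \<subseteq> V \<inter> {x. n \<bullet> x = k}"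
    using hull_subset[of F convex] by blast
  then show "convex hull V \<inter> {x. n \<bullet> x = k} \<subseteq> convex hull (V \<inter> {x. n \<bullet> x = k})"
    using F(2) by (simp add: hull_mono)
next
  show "convex hull (V \<inter> {x. n \<bullet> x = k}) \<subseteq> convex hull V \<inter> {x. n \<bullet> x = k}"
    by (intro hull_minimal Int_mono hull_subset order_refl convex_Int convex_convex_hull convex_hyperplane)
qed

text \<open>The trace on the supporting line is spanned by the vertices on it, of which there are at most two.
  Tiles inside the big triangle are in this position with respect to each of its sides.\<close>

lemma triangle_supporting_line_cases:
  fixes U V W :: "'a::euclidean_space"
  assumes "n \<bullet> U \<ge> k" "n \<bullet> V \<ge> k" "n \<bullet> W \<ge> k"
    and "\<not> (n \<bullet> U = k \<and> n \<bullet> V = k \<and> n \<bullet> W = k)"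
  shows "(\<exists>v. convex hull {U, V, W} \<inter> {x. n \<bullet> x = k} \<subseteq> {v}) \<or>
    convex hull {U, V, W} \<inter> {x. n \<bullet> x = k} = closed_segment U V \<or>
    convex hull {U, V, W} \<inter> {x. n \<bullet> x = k} = closed_segment V W \<or>
    convex hull {U, V, W} \<inter> {x. n \<bullet> x = k} = closed_segment W U"
proof -
  have face: "convex hull {U, V, W} \<inter> {x. n \<bullet> x = k} = convex hull ({U, V, W} \<inter> {x. n \<bullet> x = k})"
    using assms(1-3) by (intro convex_hull_Int_supporting_hyperplane) auto
  show ?thesis
    unfolding face using assms(4)
    by (cases "n \<bullet> U = k"; cases "n \<bullet> V = k"; cases "n \<bullet> W = k")
      (auto simp: segment_convex_hull insert_commute Int_insert_left)
qed

text \<open>In the plane the orthogonal complement of a nonzero vector is a line.\<close>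

lemma parallel_normals_plane:
  fixes n u d :: "real^2"
  assumes "d \<noteq> 0" "n \<noteq> 0" "n \<bullet> d = 0" "u \<bullet> d = 0"
  obtains t where "u = t *\<^sub>R n"
proof -
  have *: "n$1 * d$1 + n$2 * d$2 = 0" "u$1 * d$1 + u$2 * d$2 = 0"
    using assms(3,4) by (simp_all add: inner_vec_def sum_2)
  have "d$1 \<noteq> 0 \<or> d$2 \<noteq> 0" "n$1 \<noteq> 0 \<or> n$2 \<noteq> 0"
    using assms(1,2) by (auto simp: vec_eq_iff forall_2)
  \<comment> \<open>Eliminating one coordinate of \<open>d\<close> from the two orthogonality equations leaves
    the determinant of \<open>u\<close> and \<open>n\<close> times the other.\<close>
  moreover have "(u$1 * n$2 - u$2 * n$1) * d$1 = n$2 * (u$1 * d$1 + u$2 * d$2) - u$2 * (n$1 * d$1 + n$2 * d$2)"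
    "(u$1 * n$2 - u$2 * n$1) * d$2 = u$1 * (n$1 * d$1 + n$2 * d$2) - n$1 * (u$1 * d$1 + u$2 * d$2)"
    by algebra+
  ultimately have cross: "u$1 * n$2 = u$2 * n$1"
    using * by auto
  show thesis
  proof (cases "n$1 = 0")
    case True
    then show thesis
      using cross \<open>n$1 \<noteq> 0 \<or> n$2 \<noteq> 0\<close> by (intro that[of "u$2 / n$2"]) (auto simp: vec_eq_iff forall_2)
  next
    case False
    then show thesis
      using cross by (intro that[of "u$1 / n$1"]) (auto simp: vec_eq_iff forall_2 field_simps)
  qed
qed

text \<open>A line separates the two convex bodies. If they shared two points of the line \<open>n \<bullet> x = k\<close>, the
  separating line would contain both points and so would be the line \<open>n \<bullet> x = k\<close> itself; but both
  bodies lie on the same side of that line, so one of them would be contained in it and have empty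
  interior.\<close>

lemma same_side_contact_unique:
  fixes S T :: "(real^2) set"
  assumes conv: "convex S" "convex T" and closed: "closed S" "closed T"
    and int: "interior S \<noteq> {}" "interior T \<noteq> {}" "interior S \<inter> interior T = {}"
    and side: "S \<subseteq> {x. n \<bullet> x \<ge> k}" "T \<subseteq> {x. n \<bullet> x \<ge> k}" and "n \<noteq> 0"
    and p: "p \<in> S \<inter> T" "n \<bullet> p = k" and q: "q \<in> S \<inter> T" "n \<bullet> q = k"
  shows "p = q"
proof (rule ccontr)
  assume "p \<noteq> q"
  obtain u r where "u \<noteq> 0" and "\<forall>x\<in>interior S. u \<bullet> x \<le> r" "\<forall>x\<in>interior T. r \<le> u \<bullet> x"
    using separating_hyperplane_sets[of "interior S" "interior T"] conv int by (auto simp: convex_interior)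
  then have "closure (interior S) \<subseteq> {x. u \<bullet> x \<le> r}" "closure (interior T) \<subseteq> {x. u \<bullet> x \<ge> r}"
    by (intro closure_minimal closed_halfspace_le closed_halfspace_ge; blast)+
  then have sep: "S \<subseteq> {x. u \<bullet> x \<le> r}" "T \<subseteq> {x. u \<bullet> x \<ge> r}"
    using conv closed int by (simp_all add: convex_closure_interior)
  have "u \<bullet> p = r" "u \<bullet> q = r"
    using p q sep by force+
  then obtain t where t: "u = t *\<^sub>R n"
    using parallel_normals_plane[of "p - q" n u] \<open>p \<noteq> q\<close> \<open>n \<noteq> 0\<close> p q
    by (auto simp: inner_diff_right)
  have r: "r = t * k"
    using \<open>u \<bullet> p = r\<close> p t by simp
  have flat: "interior Z = {}" if "Z \<subseteq> {x. n \<bullet> x = k}" for Z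
    using interior_mono[OF that] interior_hyperplane[OF \<open>n \<noteq> 0\<close>] by auto
  show False
  proof (cases "t > 0")
    case True
    have "n \<bullet> x = k" if "x \<in> S" for x
    proof -
      have "t * (n \<bullet> x) \<le> t * k"
        using sep(1) that by (auto simp: t r)
      then have "n \<bullet> x \<le> k"
        using True by simp
      then show ?thesis
        using side(1) that by force
    qed
    then have "S \<subseteq> {x. n \<bullet> x = k}"
      by blast
    then show False using flat int by blast
  next
    case False
    then have "t < 0"
      using t \<open>u \<noteq> 0\<close> by (cases "t = 0") auto
    have "n \<bullet> x = k" if "x \<in> T" for x
    proof -
      have "t * (n \<bullet> x) \<ge> t * k"
        using sep(2) that by (auto simp: t r)
      then have "n \<bullet> x \<le> k"
        using \<open>t < 0\<close> by simp
      then show ?thesis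
        using side(2) that by force
    qed
    then have "T \<subseteq> {x. n \<bullet> x = k}"
      by blast
    then show False using flat int by blast
  qed
qed

text \<open>Lengths along \<open>AB\<close> are measured in the parameter \<open>t\<close> of \<open>A + t (B - A)\<close>, so that Lebesgue
  measure on the real line can be used for them.\<close>

lemma measure_subsegment_parameters:
  fixes A B v w :: "'a::euclidean_space"
  assumes "A \<noteq> B" "v \<in> closed_segment A B" "w \<in> closed_segment A B"
  shows "measure lebesgue {t \<in> {0..1}. A + t *\<^sub>R (B - A) \<in> closed_segment v w} = dist v w / dist A B"
proof -
  define g where "g t = A + t *\<^sub>R (B - A)" for t
  have inj: "g s = g t \<longleftrightarrow> s = t" for s t
    using assms(1) by (simp add: g_def)
  have gseg: "g ` closed_segment s t = closed_segment (g s) (g t)" for s t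
  proof -
    have "g ` closed_segment s t = (\<lambda>x. A + x) ` ((\<lambda>t. t *\<^sub>R (B - A)) ` closed_segment s t)"
      by (simp add: g_def image_image)
    also have "\<dots> = closed_segment (g s) (g t)"
      by (simp add: closed_segment_linear_image[symmetric] closed_segment_translation g_def
          linear_scaleR_left)
    finally show ?thesis .
  qed
  have "closed_segment A B = g ` {0..1}"
    using gseg[of 0 1] by (simp add: g_def closed_segment_eq_real_ivl)
  then obtain s t where s: "s \<in> {0..1}" "v = g s" and t: "t \<in> {0..1}" "w = g t"
    using assms by auto
  have "{t \<in> {0..1}. g t \<in> closed_segment v w} = closed_segment s t"
    unfolding s t gseg[symmetric] using s t inj
    by (auto simp: closed_segment_eq_real_ivl split: if_splits)
  moreover have "dist v w = \<bar>s - t\<bar> * dist A B"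
  proof -
    have "g s - g t = (s - t) *\<^sub>R (B - A)"
      by (simp add: g_def algebra_simps)
    then show ?thesis
      by (simp add: s t dist_norm norm_minus_commute)
  qed
  ultimately show ?thesis
    using assms(1) by (simp add: g_def closed_segment_eq_real_ivl)
qed

text \<open>The traces of the tiles on \<open>AB\<close> cover it and overlap pairwise in at most one point, so their
  lengths \<open>l S\<close> add up to the length of \<open>AB\<close>. Each trace is an edge of its tile, or has length \<open>0\<close>.\<close>

lemma triangle_tiling_side_length:
  assumes tiling: "tiling N (triangle_region A B C) (triangle_region P Q R) \<T>"
    and PQR: "\<not> collinear {P, Q, R}" and ABC: "\<not> collinear {A, B, C}"
  obtains l where "\<And>S. S \<in> \<T> \<Longrightarrow> l S \<in> {0, dist P Q, dist Q R, dist R P}"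
    and "dist A B = (\<Sum>S\<in>\<T>. l S)"
proof -
  have fin: "finite \<T>" and cong: "\<And>S. S \<in> \<T> \<Longrightarrow> congruent_regions (triangle_region P Q R) S"
    and disj: "pairwise (\<lambda>S S'. interior S \<inter> interior S' = {}) \<T>"
    and cover: "\<Union>\<T> = triangle_region A B C"
    using tiling by (auto simp: tiling_def)
  have AB: "A \<noteq> B"
    using ABC by auto
  obtain n where nB: "n \<bullet> B = n \<bullet> A" and nC: "n \<bullet> C > n \<bullet> A"
    using edge_normal_exists[OF ABC] by blast
  define k where "k = n \<bullet> A"
  have n0: "n \<noteq> 0"
    using nC by auto
  have ABCside: "triangle_region A B C \<subseteq> {x. n \<bullet> x \<ge> k}"
    using nB nC by (intro hull_minimal) (auto simp: k_def convex_halfspace_ge)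
  have side: "S \<subseteq> {x. n \<bullet> x \<ge> k}" if "S \<in> \<T>" for S
    using that cover ABCside by blast
  have "{A, B, C} \<inter> {x. n \<bullet> x = k} = {A, B}"
    using nB nC by (auto simp: k_def)
  then have ABedge: "triangle_region A B C \<inter> {x. n \<bullet> x = k} = closed_segment A B"
    by (subst convex_hull_Int_supporting_hyperplane)
      (use nB nC in \<open>auto simp: k_def segment_convex_hull\<close>)
  define g where "g t = A + t *\<^sub>R (B - A)" for t :: real
  have g_line: "n \<bullet> g t = k" for t
    using nB by (simp add: g_def k_def inner_add_right inner_diff_right)
  have g_inj: "g s = g t \<longleftrightarrow> s = t" for s t
    using AB by (simp add: g_def)
  have g_seg: "g t \<in> closed_segment A B" if "t \<in> {0..1}" for t
    using that by (auto simp: g_def closed_segment_def algebra_simps intro!: exI[of _ t])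
  \<comment> \<open>\<open>E S\<close> is the trace of \<open>S\<close> on \<open>AB\<close>, as a set of parameters.\<close>
  define E where "E S = {t \<in> {0..1}. g t \<in> S}" for S
  have tile: "convex S \<and> compact S \<and> interior S \<noteq> {}
      \<and> measure lebesgue (E S) * dist A B \<in> {0, dist P Q, dist Q R, dist R P}" if S: "S \<in> \<T>" for S
  proof -
    obtain U V W where T: "S = triangle_region U V W"
      and d: "dist U V = dist P Q" "dist V W = dist Q R" "dist W U = dist R P"
      using congruent_triangle_vertices[OF cong[OF S]] by metis
    have cc: "convex S" "compact S"
      by (auto simp: T finite_imp_compact_convex_hull)
    have "measure lebesgue (triangle_region P Q R) > 0"
      using interior_triangle_nonempty[OF PQR] measure_convex_pos_iff[of "triangle_region P Q R"]
      by (simp add: finite_imp_compact_convex_hull)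
    then have int: "interior S \<noteq> {}"
      using measure_convex_pos_iff[OF cc] measure_triangle_cong[OF d] T by simp
    have verts: "U \<in> S" "V \<in> S" "W \<in> S"
      by (auto simp: T hull_inc)
    have "\<not> (n \<bullet> U = k \<and> n \<bullet> V = k \<and> n \<bullet> W = k)"
    proof
      assume "n \<bullet> U = k \<and> n \<bullet> V = k \<and> n \<bullet> W = k"
      then have "S \<subseteq> {x. n \<bullet> x = k}"
        unfolding T by (intro hull_minimal) (auto simp: convex_hyperplane)
      then have "interior S \<subseteq> interior {x. n \<bullet> x = k}"
        by (rule interior_mono)
      then show False
        using int interior_hyperplane[OF n0] by auto
    qed
    moreover have "n \<bullet> U \<ge> k" "n \<bullet> V \<ge> k" "n \<bullet> W \<ge> k"
      using verts side[OF S] by auto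
    ultimately have cases: "(\<exists>v. S \<inter> {x. n \<bullet> x = k} \<subseteq> {v}) \<or>
        S \<inter> {x. n \<bullet> x = k} = closed_segment U V \<or>
        S \<inter> {x. n \<bullet> x = k} = closed_segment V W \<or>
        S \<inter> {x. n \<bullet> x = k} = closed_segment W U"
      unfolding T by (intro triangle_supporting_line_cases)
    have E: "E S = {t \<in> {0..1}. g t \<in> S \<inter> {x. n \<bullet> x = k}}"
      using g_line by (auto simp: E_def)
    have edge: "measure lebesgue (E S) * dist A B = dist v w"
      if "S \<inter> {x. n \<bullet> x = k} = closed_segment v w" for v w
    proof -
      have "closed_segment v w \<subseteq> closed_segment A B"
        using that S cover ABedge by blast
      then have "v \<in> closed_segment A B" "w \<in> closed_segment A B"
        by auto
      then have "measure lebesgue (E S) = dist v w / dist A B"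
        using measure_subsegment_parameters[OF AB] unfolding E that g_def by blast
      then show ?thesis
        using AB by simp
    qed
    have point: "measure lebesgue (E S) = 0" if v: "S \<inter> {x. n \<bullet> x = k} \<subseteq> {v}" for v
    proof (cases "E S = {}")
      case False
      then obtain t where "t \<in> E S"
        by blast
      have "E S \<subseteq> {t}"
      proof
        fix s assume "s \<in> E S"
        then have "g s = v" "g t = v"
          using \<open>t \<in> E S\<close> v unfolding E by blast+
        then show "s \<in> {t}"
          using g_inj[of s t] by simp
      qed
      then show ?thesis
        by (metis negligible_sing negligible_subset negligible_imp_measure0)
    qed simp
    have "measure lebesgue (E S) * dist A B \<in> {0, dist P Q, dist Q R, dist R P}"
      using cases edge point d by force
    with cc int show ?thesis by blast
  qed
  have cont: "continuous_on UNIV g"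
    by (auto simp: g_def intro!: continuous_intros)
  have "measure lebesgue (\<Union> (E ` \<T>)) = (\<Sum>S\<in>\<T>. measure lebesgue (E S))"
  proof (rule measure_negligible_finite_Union_image[OF fin])
    fix S assume S: "S \<in> \<T>"
    have "closed (g -` S)"
      using tile[OF S] cont by (simp add: closed_vimage compact_imp_closed)
    moreover have "E S = {0..1} \<inter> g -` S"
      by (auto simp: E_def)
    ultimately show "E S \<in> lmeasurable"
      by (auto intro!: lmeasurable_compact compact_Int_closed)
  next
    show "pairwise (\<lambda>S S'. negligible (E S \<inter> E S')) \<T>"
    proof (rule pairwiseI)
      fix S S' assume SS: "S \<in> \<T>" "S' \<in> \<T>" "S \<noteq> S'"
      have "interior S \<inter> interior S' = {}"
        using disj SS by (auto simp: pairwise_def)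
      then have unique: "p = q" if "p \<in> S \<inter> S'" "n \<bullet> p = k" "q \<in> S \<inter> S'" "n \<bullet> q = k" for p q
        using tile[OF SS(1)] tile[OF SS(2)] side SS n0 that
        by (intro same_side_contact_unique[where S = S and T = S' and n = n and k = k])
          (auto simp: compact_imp_closed)
      have "s = t" if "s \<in> E S \<inter> E S'" "t \<in> E S \<inter> E S'" for s t
        using unique[of "g s" "g t"] g_line g_inj that by (auto simp: E_def)
      then have "\<exists>t. E S \<inter> E S' \<subseteq> {t}"
        by (metis subsetI singletonI)
      then show "negligible (E S \<inter> E S')"
        using negligible_sing negligible_subset by metis
    qed
  qed
  moreover have "\<Union> (E ` \<T>) = {0..1}"
  proof -
    have "closed_segment A B \<subseteq> \<Union>\<T>"
      unfolding cover segment_convex_hull by (rule hull_mono) auto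
    then have "\<exists>S\<in>\<T>. g t \<in> S" if "t \<in> {0..1}" for t
      using g_seg[OF that] by blast
    then show ?thesis
      by (auto simp: E_def)
  qed
  ultimately have "(\<Sum>S\<in>\<T>. measure lebesgue (E S)) = 1"
    by simp
  then have "dist A B = (\<Sum>S\<in>\<T>. measure lebesgue (E S) * dist A B)"
    by (simp add: sum_distrib_right[symmetric])
  with tile show thesis
    by (intro that[of "\<lambda>S. measure lebesgue (E S) * dist A B"]) blast+
qed

section \<open>Metric relations in a triangle\<close>

lemma inner_eq_cos_vertex_angle:
  "(P - Q) \<bullet> (R - Q) = dist P Q * dist R Q * cos (vertex_angle P Q R)"
proof (cases "P = Q \<or> R = Q")
  case False
  define z where "z = ((P - Q) \<bullet> (R - Q)) / (norm (P - Q) * norm (R - Q))"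
  have "\<bar>z\<bar> \<le> 1"
    using Cauchy_Schwarz_ineq2[of "P - Q" "R - Q"] False by (simp add: z_def abs_divide abs_mult)
  then have "cos (vertex_angle P Q R) = z"
    by (simp add: vertex_angle_def z_def[symmetric] cos_arccos abs_le_iff)
  then show ?thesis
    using False by (simp add: z_def dist_norm)
qed auto

lemma cosine_rule:
  "(dist P R)\<^sup>2 = (dist P Q)\<^sup>2 + (dist R Q)\<^sup>2 - 2 * dist P Q * dist R Q * cos (vertex_angle P Q R)"
proof -
  have "(dist P R)\<^sup>2 = (dist P Q)\<^sup>2 + (dist R Q)\<^sup>2 - 2 * ((P - Q) \<bullet> (R - Q))"
    by (simp add: dist_norm power2_norm_eq_inner inner_diff_left inner_diff_right inner_commute)
  then show ?thesis
    by (simp add: inner_eq_cos_vertex_angle)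
qed

text \<open>Heron's formula free of square roots and in even powers of the sides, which suits the
  substitution of \<open>c\<^sup>2 = a\<^sup>2 + a b + b\<^sup>2\<close>.\<close>

lemma heron_sixteen_area_squared:
  fixes A B C :: "real^2"
  defines "a \<equiv> dist B C" and "b \<equiv> dist A C" and "c \<equiv> dist A B"
  shows "16 * (measure lebesgue (triangle_region A B C))\<^sup>2 = 4 * a\<^sup>2 * b\<^sup>2 - (a\<^sup>2 + b\<^sup>2 - c\<^sup>2)\<^sup>2"
proof -
  have nn: "(a+b+c)/2 * ((a+b+c)/2 - a) * ((a+b+c)/2 - b) * ((a+b+c)/2 - c) \<ge> 0"
    using dist_triangle[of A B C] dist_triangle[of A C B] dist_triangle[of B C A]
    by (intro mult_nonneg_nonneg) (auto simp: a_def b_def c_def dist_commute)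
  have "measure lebesgue (triangle_region A B C) =
      sqrt ((a+b+c)/2 * ((a+b+c)/2 - a) * ((a+b+c)/2 - b) * ((a+b+c)/2 - c))"
    using heron[of A B C]
    by (simp add: a_def b_def c_def measure_completion borel_compact finite_imp_compact_convex_hull)
  then have "16 * (measure lebesgue (triangle_region A B C))\<^sup>2 =
      16 * ((a+b+c)/2 * ((a+b+c)/2 - a) * ((a+b+c)/2 - b) * ((a+b+c)/2 - c))"
    using nn by (simp only: real_sqrt_pow2)
  also have "\<dots> = 4 * a\<^sup>2 * b\<^sup>2 - (a\<^sup>2 + b\<^sup>2 - c\<^sup>2)\<^sup>2"
    by (simp add: field_simps power2_eq_square)
  finally show ?thesis .
qed

section \<open>Arithmetic of the tile and conclusion\<close>

text \<open>Modulo a common divisor \<open>d\<close> of \<open>2 b + a\<close> and \<open>c\<close> one has \<open>a = - 2 b\<close>, so that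
  \<open>0 = c\<^sup>2 = 3 b\<^sup>2\<close>; as \<open>d\<close> is coprime to \<open>b\<close>, it divides \<open>3\<close>. The divisor \<open>3\<close> is excluded modulo
  \<open>9\<close>: \<open>c\<^sup>2\<close> would be a multiple of \<open>9\<close> congruent to \<open>3 b\<^sup>2\<close>, so that \<open>3\<close>
  would divide both \<open>b\<close> and \<open>2 b + a\<close>.\<close>

lemma tile_sides_coprime:
  fixes a b c :: int
  assumes tri: "c\<^sup>2 = a\<^sup>2 + a * b + b\<^sup>2" and Gcd: "Gcd {a, b, c} = 1"
  shows "coprime (2 * b + a) b" "coprime (2 * b + a) c"
proof -
  have ab: "coprime a b"
  proof (rule coprimeI)
    fix d assume d: "d dvd a" "d dvd b"
    then have "d\<^sup>2 dvd a\<^sup>2 + a * b + b\<^sup>2"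
      unfolding power2_eq_square by (intro dvd_add mult_dvd_mono)
    then have "d\<^sup>2 dvd c\<^sup>2"
      by (simp only: tri)
    then have "d dvd c"
      by simp
    then have "d dvd Gcd {a, b, c}"
      using d by (intro Gcd_greatest) auto
    then show "is_unit d"
      by (simp only: Gcd)
  qed
  have common: "is_unit d" if "d dvd 2 * b + a" "d dvd b" for d
  proof -
    have "d dvd a"
      using that by (metis dvd_add_right_iff dvd_mult)
    then show ?thesis
      using ab that by (meson coprime_common_divisor)
  qed
  then show cop_b: "coprime (2 * b + a) b"
    by (rule coprimeI)
  show "coprime (2 * b + a) c"
  proof (rule coprimeI)
    fix d assume d: "d dvd 2 * b + a" "d dvd c"
    have "3 * b\<^sup>2 = c * c - (2 * b + a) * (a - b)"
      using tri by (simp add: power2_eq_square algebra_simps)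
    then have "d dvd 3 * b\<^sup>2"
      using d by simp
    moreover have "coprime d (b\<^sup>2)"
      using common d by (auto intro!: coprimeI dvd_trans[OF _ d(1)])
    ultimately have "d dvd 3"
      by (simp add: coprime_dvd_mult_left_iff)
    have "\<not> 3 dvd d"
    proof
      assume "3 dvd d"
      then obtain j m where j: "2 * b + a = 3 * j" and m: "c = 3 * m"
        using d by (meson dvdE dvd_trans)
      have "3 * b\<^sup>2 = c * c - (2 * b + a) * (2 * b + a - 3 * b)"
        using tri by (simp add: power2_eq_square algebra_simps)
      also have "\<dots> = 3 * (3 * (m * m - j * (j - b)))"
        unfolding j m by (simp add: algebra_simps)
      finally have "b\<^sup>2 = 3 * (m * m - j * (j - b))"
        by simp
      then have "3 dvd b\<^sup>2"
        by simp
      moreover have "coprime 3 (b\<^sup>2)"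
        using cop_b by (simp add: j)
      ultimately have "is_unit (3 :: int)"
        using coprime_common_divisor dvd_refl by blast
      then show False
        by simp
    qed
    moreover have "d \<in> {-3, -2, -1, 0, 1, 2, 3}"
      using dvd_imp_le_int[of 3 d] \<open>d dvd 3\<close> by auto
    ultimately show "is_unit d"
      using \<open>d dvd 3\<close> by auto
  qed
qed

theorem lemma12p9:
  fixes A B C P Q R :: "real^2"
    and a b c :: int
    and \<alpha> \<beta> :: real
    and N :: nat
  assumes tile: "triangle_with_sides_angles P Q R (of_int a) (of_int b) (of_int c) \<alpha> \<beta> (2 * pi / 3)"
    and no_common_factor: "Gcd {a, b, c} = 1"
    and irrational: "\<alpha> / pi \<notin> \<rat>"
    and isosceles: "isosceles_with_apex A B C"
    and base_angles: "vertex_angle B A C = \<alpha>" "vertex_angle B C A = \<alpha>"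
    and tiled: "tiled_by N (triangle_region A B C) (triangle_region P Q R)"
  shows "(2 * b + a) dvd int N \<and>
         (\<exists>m::nat. m > 0 \<and>
            real N * real_of_int b / real_of_int (2 * b + a) = (real m)\<^sup>2 \<and>
            dist A B = real m * real_of_int c \<and>
            dist B C = real m * real_of_int c \<and>
            dist A C = real m * real_of_int (2 * b + a))"
proof -
  have nPQR: "\<not> collinear {P, Q, R}" and QR: "dist Q R = of_int a" and RP: "dist R P = of_int b"
    and PQ: "dist P Q = of_int c" and angP: "vertex_angle R P Q = \<alpha>"
    and angR: "vertex_angle Q R P = 2 * pi / 3"
    using tile by (auto simp: triangle_with_sides_angles_def nondegenerate_triangle_def)
  have nABC: "\<not> collinear {A, B, C}" and BC: "dist B C = dist A B"
    using isosceles by (auto simp: isosceles_with_apex_def nondegenerate_triangle_def)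
  have "P \<noteq> Q" "Q \<noteq> R" "R \<noteq> P" "A \<noteq> B" "A \<noteq> C"
    using nPQR nABC by (auto simp: insert_commute)
  then have pos: "a > 0" "b > 0" "c > 0" and X0: "dist A B > 0" and Y0: "dist A C > 0"
    using QR RP PQ by (metis of_int_0_less_iff zero_less_dist_iff)+
  define X Y where "X = dist A B" and "Y = dist A C"
  have tri: "c\<^sup>2 = a\<^sup>2 + a * b + b\<^sup>2"
  proof -
    have "(of_int c :: real)\<^sup>2 = of_int a ^ 2 + of_int b ^ 2 + of_int a * of_int b"
      using cosine_rule[of Q P R] by (simp add: angR cos_120 QR RP PQ dist_commute[of Q P] dist_commute[of P R])
    then show ?thesis
      by (metis (mono_tags, opaque_lifting) add.commute add.left_commute of_int_add of_int_eq_iff of_int_mult of_int_power)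
  qed
  then have trir: "(of_int c :: real)\<^sup>2 = of_int a ^ 2 + of_int a * of_int b + of_int b ^ 2"
    by (metis of_int_add of_int_mult of_int_power)
  have YX: "Y * of_int c = X * of_int (2 * b + a)"
  proof -
    have "Y\<^sup>2 = 2 * X * Y * cos \<alpha>"
      using cosine_rule[of B C A] base_angles BC
      by (simp add: X_def Y_def dist_commute[of B A] dist_commute[of C A])
    then have Y: "Y = 2 * X * cos \<alpha>"
      using Y0 by (simp add: Y_def power2_eq_square)
    have "of_int a ^ 2 = of_int b ^ 2 + of_int c ^ 2 - 2 * of_int b * of_int c * cos \<alpha>"
      using cosine_rule[of R Q P] by (simp add: angP QR RP PQ dist_commute[of Q P] dist_commute[of R Q])
    then have "of_int b * (2 * of_int c * cos \<alpha>) = of_int b * (2 * of_int b + of_int a)"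
      using trir by (simp add: power2_eq_square algebra_simps)
    then have "2 * of_int c * cos \<alpha> = 2 * of_int b + of_int a"
      using pos by simp
    then show ?thesis
      unfolding Y by (simp add: algebra_simps)
  qed
  obtain \<T> where T: "tiling N (triangle_region A B C) (triangle_region P Q R) \<T>"
    using tiled by (auto simp: tiled_by_def)
  obtain x :: int where x: "X = of_int x"
  proof -
    obtain l where l: "\<And>S. S \<in> \<T> \<Longrightarrow> l S \<in> {0, dist P Q, dist Q R, dist R P}" "dist A B = (\<Sum>S\<in>\<T>. l S)"
      using triangle_tiling_side_length[OF T nPQR nABC] by metis
    have "(\<Sum>S\<in>\<T>. l S) \<in> \<int>"
      using l(1) QR RP PQ by (intro Ints_sum) (metis Ints_0 Ints_of_int empty_iff insert_iff)
    then show thesis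
      using that l(2) by (auto simp: X_def Ints_def)
  qed
  have area: "Y\<^sup>2 = of_int (int N * b * (2 * b + a))"
  proof -
    have ABC: "16 * (measure lebesgue (triangle_region A B C))\<^sup>2 = Y\<^sup>2 * (4 * X\<^sup>2 - Y\<^sup>2)"
      using heron_sixteen_area_squared[of A B C] BC
      by (simp add: X_def Y_def power2_eq_square algebra_simps)
    have PQR: "16 * (measure lebesgue (triangle_region P Q R))\<^sup>2 = 3 * (of_int a)\<^sup>2 * (of_int b)\<^sup>2"
      using heron_sixteen_area_squared[of P Q R]
      unfolding QR RP PQ dist_commute[of P R] trir by (simp add: power2_eq_square algebra_simps)
    have eq: "Y\<^sup>2 * (4 * X\<^sup>2 - Y\<^sup>2) = (real N)\<^sup>2 * (3 * (of_int a)\<^sup>2 * (of_int b)\<^sup>2)"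
      unfolding ABC[symmetric] PQR[symmetric] triangle_tiling_area[OF T]
      by (simp add: power_mult_distrib)
    \<comment> \<open>The identity \<open>4 c\<^sup>2 - (2 b + a)\<^sup>2 = 3 a\<^sup>2\<close> cancels the factor \<open>3 a\<^sup>2\<close> of the tile area.\<close>
    let ?s = "of_int (2 * b + a) :: real"
    have "(Y\<^sup>2)\<^sup>2 * (3 * (of_int a)\<^sup>2) = Y\<^sup>2 * Y\<^sup>2 * (4 * (of_int c)\<^sup>2 - ?s\<^sup>2)"
      unfolding trir by (simp add: power2_eq_square algebra_simps)
    also have "\<dots> = Y\<^sup>2 * (4 * (Y * of_int c)\<^sup>2 - Y\<^sup>2 * ?s\<^sup>2)"
      by (simp add: power2_eq_square algebra_simps)
    also have "\<dots> = ?s\<^sup>2 * (Y\<^sup>2 * (4 * X\<^sup>2 - Y\<^sup>2))"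
      unfolding YX by (simp only: power2_eq_square) (simp add: algebra_simps)
    also have "\<dots> = (real N * of_int b * ?s)\<^sup>2 * (3 * (of_int a)\<^sup>2)"
      unfolding eq by (simp add: power_mult_distrib)
    finally have "(Y\<^sup>2)\<^sup>2 = (real N * of_int b * ?s)\<^sup>2"
      using pos by simp
    then show ?thesis
      using pos by (subst (asm) power2_eq_iff_nonneg) auto
  qed
  have eqi: "c\<^sup>2 * (int N * b) = x\<^sup>2 * (2 * b + a)"
  proof -
    have "(of_int (c\<^sup>2 * (int N * b) * (2 * b + a)) :: real) = (Y * of_int c)\<^sup>2"
      using area by (simp add: power_mult_distrib)
    also have "\<dots> = of_int (x\<^sup>2 * (2 * b + a) * (2 * b + a))"
      unfolding YX x by (simp add: power2_eq_square)
    finally have "c\<^sup>2 * (int N * b) * (2 * b + a) = x\<^sup>2 * (2 * b + a) * (2 * b + a)"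
      by (simp only: of_int_eq_iff)
    then show ?thesis
      using pos by simp
  qed
  note coprime = tile_sides_coprime[OF tri no_common_factor]
  have "c\<^sup>2 dvd x\<^sup>2 * (2 * b + a)"
    using eqi by (metis dvd_triv_left)
  then have "c\<^sup>2 dvd x\<^sup>2"
    using coprime(2) by (simp add: coprime_dvd_mult_left_iff coprime_commute)
  then have "c dvd x"
    by simp
  then obtain y where y: "x = c * y" ..
  have "x > 0"
    using X0 unfolding X_def[symmetric] x by simp
  then have "y > 0"
    using y pos by (simp add: zero_less_mult_iff)
  then obtain m :: nat where m: "x = c * int m" "m > 0"
    using y by (metis pos_int_cases)
  have Nb: "int N * b = (int m)\<^sup>2 * (2 * b + a)"
    using eqi pos by (simp add: m power_mult_distrib)
  then have "(2 * b + a) dvd int N * b"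
    by simp
  then have "(2 * b + a) dvd int N"
    using coprime(1) by (simp add: coprime_dvd_mult_left_iff)
  moreover have "real N * of_int b / of_int (2 * b + a) = (real m)\<^sup>2"
  proof -
    have "real N * of_int b = (real m)\<^sup>2 * of_int (2 * b + a)"
      using arg_cong[OF Nb, of real_of_int] by simp
    then show ?thesis
      using pos by (simp add: field_simps)
  qed
  moreover have X: "X = real m * of_int c"
    by (simp add: x m)
  moreover have "Y = real m * of_int (2 * b + a)"
    using YX pos unfolding X by simp
  ultimately show ?thesis
    using m(2) BC by (auto simp: X_def Y_def)
qed

end
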